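(* Let $V$ and $W$ be vector spaces over $\mathbb{Q}$ and let $n\in\mathbb{N}$, $n\ge 1$. If the mapping $f:V^n\to W$ is multi-cubic, then $f$ satisfies the equation $$\sum_{q\in\{-1,1\}^n} f(2x_1+qx_2)=\sum_{k=0}^{n}2^{n-k}12^{k}f(\mathcal M_{k}^n)$$ for all $x_1,x_2\in V^n$, where $f(\mathcal M_k^n)=\sum_{s} f(x_1+sx_2)$, the sum being over all $s\in\{-1,0,1\}^n$ having exactly $k$ entries equal to $0$.
   Context: For $x_i=(x_{i1},\dots,x_{in})\in V^n$ ($i\in\{1,2\}$) and $t=(t_1,\dots,t_n)\in\{-1,0,1\}^n$, write $2x_1=(2x_{11},\dots,2x_{1n})$ and $tx_2=(t_1x_{21},\dots,t_nx_{2n})$; addition in $V^n$ is componentwise. A mapping $\mathfrak C:V\to W$ is called cubic if $\mathfrak C(2x+y)+\mathfrak C(2x-y)=2\mathfrak C(x+y)+2\mathfrak C(x-y)+12\mathfrak C(x)$ for all $x,y\in V$. A mapping $f:V^n\to W$ is called multi-cubic if it is cubic in each variable, i.e. for each $j\in\{1,\dots,n\}$ and each choice of the other $n-1$ arguments, the resulting mapping of the $j$th argument is cubic. The quantity $f(\mathcal M_k^n)$ (depending on $x_1,x_2$) is the sum of $f(N_1,\dots,N_n)$ over all choices of $N_j\in\{x_{1j}+x_{2j},\,x_{1j}-x_{2j},\,x_{1j}\}$ in which exactly $k$ of the components are chosen to be $x_{1j}$. *)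

theory Defs
  imports "HOL-Analysis.Finite_Cartesian_Product"
begin

text \<open>
  A vector space over the rationals is a type of class \<^class>\<open>ab_group_add\<close> with a rational scalar
  multiplication \<open>s\<close> satisfying \<^locale>\<open>vector_space\<close>; \<open>V\<^sup>n\<close> is \<^typ>\<open>'v ^ 'n\<close> with \<open>n = CARD('n)\<close>.
\<close>

definition cubic ::
  "(rat \<Rightarrow> 'v \<Rightarrow> 'v) \<Rightarrow> (rat \<Rightarrow> 'w \<Rightarrow> 'w) \<Rightarrow> ('v::ab_group_add \<Rightarrow> 'w::ab_group_add) \<Rightarrow> bool"
  where
  "cubic sV sW C \<longleftrightarrow>
     (\<forall>x y. C (sV 2 x + y) + C (sV 2 x - y)
          = sW 2 (C (x + y)) + sW 2 (C (x - y)) + sW 12 (C x))"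

definition multi_cubic ::
  "(rat \<Rightarrow> 'v \<Rightarrow> 'v) \<Rightarrow> (rat \<Rightarrow> 'w \<Rightarrow> 'w) \<Rightarrow> ('v::ab_group_add ^ 'n::finite \<Rightarrow> 'w::ab_group_add) \<Rightarrow> bool"
  where
  "multi_cubic sV sW f \<longleftrightarrow>
     (\<forall>j a. cubic sV sW (\<lambda>u. f (\<chi> i. if i = j then u else a $ i)))"

definition scale_vec :: "(rat \<Rightarrow> 'v \<Rightarrow> 'v) \<Rightarrow> rat \<Rightarrow> 'v ^ 'n::finite \<Rightarrow> 'v ^ 'n"
  where "scale_vec sV c x = (\<chi> j. sV c (x $ j))"

definition scale_tuple :: "(rat \<Rightarrow> 'v \<Rightarrow> 'v) \<Rightarrow> rat ^ 'n::finite \<Rightarrow> 'v ^ 'n \<Rightarrow> 'v ^ 'n"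
  where "scale_tuple sV t x = (\<chi> j. sV (t $ j) (x $ j))"

text \<open>
  \<open>f(\<M>\<^sub>k\<^sup>n)\<close>: the entry \<open>s\<^sub>j = 1, -1, 0\<close> encodes the choice of
  \<open>x\<^sub>1\<^sub>j + x\<^sub>2\<^sub>j\<close>, \<open>x\<^sub>1\<^sub>j - x\<^sub>2\<^sub>j\<close>, \<open>x\<^sub>1\<^sub>j\<close> as the \<open>j\<close>-th argument. The sum runs over choices, so
  coinciding arguments (e.g. when \<open>x\<^sub>2\<^sub>j = 0\<close>) are counted with multiplicity.
\<close>

definition M_sum ::
  "(rat \<Rightarrow> 'v \<Rightarrow> 'v) \<Rightarrow> ('v::ab_group_add ^ 'n::finite \<Rightarrow> 'w::ab_group_add) \<Rightarrow> nat
     \<Rightarrow> 'v ^ 'n \<Rightarrow> 'v ^ 'n \<Rightarrow> 'w"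
  where
  "M_sum sV f k x1 x2 =
     (\<Sum>s | (\<forall>j. s $ j \<in> {-1, 0, 1}) \<and> card {j. s $ j = 0} = k. f (x1 + scale_tuple sV s x2))"

end

theory Submission
  imports Defs "HOL-Library.FuncSet"
begin

text \<open>
  The cubic equation in the \<open>j\<close>-th variable turns the two choices \<open>2 x\<^sub>1\<^sub>j \<plusminus> x\<^sub>2\<^sub>j\<close> into
  the three choices \<open>x\<^sub>1\<^sub>j + s x\<^sub>2\<^sub>j\<close>, with weight \<open>12\<close> for \<open>s = 0\<close> and \<open>2\<close> for \<open>s = \<plusminus>1\<close>.
  Applying this to one variable after another, a choice \<open>s \<in> {-1, 0, 1}\<^sup>n\<close> receives the product
  of its weights, which is \<open>2\<^sup>n\<^sup>-\<^sup>k 12\<^sup>k\<close> when \<open>s\<close> has \<open>k\<close> zeros.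
\<close>

lemma sum_PiE_insert:
  assumes "j \<notin> A"
  shows "sum g (Pi\<^sub>E (insert j A) B) = (\<Sum>b\<in>B j. \<Sum>q\<in>Pi\<^sub>E A B. g (q(j := b)))"
proof -
  have "sum g (Pi\<^sub>E (insert j A) B) = (\<Sum>(b, q)\<in>B j \<times> Pi\<^sub>E A B. g (q(j := b)))"
    unfolding PiE_insert_eq
    by (subst sum.reindex[OF inj_combinator[OF assms]]) (simp add: case_prod_unfold)
  then show ?thesis
    by (simp add: sum.cartesian_product)
qed

lemma override_on_insert_upd:
  "override_on h (\<lambda>i. g i ((q(j := b)) i)) (insert j A)
    = (override_on h (\<lambda>i. g i (q i)) A)(j := g j b)"
  by (auto simp: override_on_def fun_eq_iff)

lemma override_on_upd:
  assumes "j \<notin> A"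
  shows "override_on (h(j := x)) k A = (override_on h k A)(j := x)"
  using assms by (auto simp: override_on_def fun_eq_iff)

text \<open>Multilinear-style expansion, one coordinate at a time: \<open>F\<close> need not be
  linear, since \<open>expand\<close> is available at every base tuple \<open>h\<close>. The tuple
  \<open>h\<close> supplies the coordinates outside \<open>A\<close>; the induction generalizes over
  it because the induction hypothesis is applied to bases already changed at
  \<open>j\<close>.\<close>

lemma (in module) sum_PiE_expand_coordinatewise:
  assumes "finite A"
    and expand: "\<And>i h. i \<in> A \<Longrightarrow>
      (\<Sum>b\<in>B. F (h(i := u i b))) = (\<Sum>c\<in>C. scale (w c) (F (h(i := v i c))))"
  shows "(\<Sum>q\<in>A \<rightarrow>\<^sub>E B. F (override_on h (\<lambda>i. u i (q i)) A))
    = (\<Sum>s\<in>A \<rightarrow>\<^sub>E C. scale (\<Prod>i\<in>A. w (s i)) (F (override_on h (\<lambda>i. v i (s i)) A)))"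
  using assms
proof (induction A arbitrary: h rule: finite_induct)
  case empty
  then show ?case by simp
next
  case (insert j A)
  have IH: "(\<Sum>q\<in>A \<rightarrow>\<^sub>E B. F (override_on h (\<lambda>i. u i (q i)) A))
    = (\<Sum>s\<in>A \<rightarrow>\<^sub>E C. scale (\<Prod>i\<in>A. w (s i)) (F (override_on h (\<lambda>i. v i (s i)) A)))" for h
    using insert.IH insert.prems by blast
  have weight: "(\<Prod>i\<in>insert j A. w ((s(j := c)) i)) = (\<Prod>i\<in>A. w (s i)) * w c" for s c
  proof -
    have "(\<Prod>i\<in>A. w ((s(j := c)) i)) = (\<Prod>i\<in>A. w (s i))"
      using insert.hyps by (intro prod.cong) auto
    then show ?thesis using insert.hyps by (simp add: mult.commute)
  qed
  \<comment> \<open>As \<open>j\<close> lies outside \<open>A\<close>, its value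
    \<open>u j b\<close> can be absorbed into the base tuple, which leaves an instance of
    \<open>IH\<close> for each \<open>b\<close>.\<close>
  have "(\<Sum>q\<in>insert j A \<rightarrow>\<^sub>E B. F (override_on h (\<lambda>i. u i (q i)) (insert j A)))
      = (\<Sum>b\<in>B. \<Sum>q\<in>A \<rightarrow>\<^sub>E B. F (override_on (h(j := u j b)) (\<lambda>i. u i (q i)) A))"
    by (simp only: sum_PiE_insert[OF insert.hyps(2)] override_on_insert_upd
        override_on_upd[OF insert.hyps(2)])
  also have "\<dots> = (\<Sum>b\<in>B. \<Sum>s\<in>A \<rightarrow>\<^sub>E C. scale (\<Prod>i\<in>A. w (s i))
      (F ((override_on h (\<lambda>i. v i (s i)) A)(j := u j b))))"
    unfolding IH unfolding override_on_upd[OF insert.hyps(2)] ..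
  \<comment> \<open>With \<open>s\<close> fixed, the inner sum varies only coordinate
    \<open>j\<close>, so \<open>expand\<close> applies at the base whose coordinates in
    \<open>A\<close> are already of the form \<open>v i (s i)\<close>.\<close>
  also have "\<dots> = (\<Sum>s\<in>A \<rightarrow>\<^sub>E C. scale (\<Prod>i\<in>A. w (s i))
      (\<Sum>b\<in>B. F ((override_on h (\<lambda>i. v i (s i)) A)(j := u j b))))"
    by (subst sum.swap) (simp add: scale_sum_right)
  also have "\<dots> = (\<Sum>s\<in>A \<rightarrow>\<^sub>E C. \<Sum>c\<in>C. scale ((\<Prod>i\<in>A. w (s i)) * w c)
      (F ((override_on h (\<lambda>i. v i (s i)) A)(j := v j c))))"
    by (simp only: insert.prems[OF insertI1] scale_sum_right scale_scale)
  also have "\<dots> = (\<Sum>c\<in>C. \<Sum>s\<in>A \<rightarrow>\<^sub>E C. scale (\<Prod>i\<in>insert j A. w ((s(j := c)) i))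
      (F (override_on h (\<lambda>i. v i ((s(j := c)) i)) (insert j A))))"
    unfolding weight override_on_insert_upd by (rule sum.swap)
  also have "\<dots> = (\<Sum>s\<in>insert j A \<rightarrow>\<^sub>E C. scale (\<Prod>i\<in>insert j A. w (s i))
      (F (override_on h (\<lambda>i. v i (s i)) (insert j A))))"
    by (simp only: sum_PiE_insert[OF insert.hyps(2)])
  finally show ?case .
qed

text \<open>Over \<open>UNIV\<close> extensionality is vacuous, so \<open>vec_lambda\<close> and
  \<open>vec_nth\<close> are mutually inverse between the two sets.\<close>

lemma bij_betw_vec_lambda_PiE:
  "bij_betw vec_lambda (UNIV \<rightarrow>\<^sub>E B) {s :: 'a ^ 'n::finite. \<forall>j. s $ j \<in> B}"
  by (rule bij_betwI[where g = vec_nth]) (auto simp: PiE_def)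

lemma sum_vec_eq_sum_PiE:
  "(\<Sum>s | \<forall>j. s $ j \<in> B. g s) = (\<Sum>s\<in>UNIV \<rightarrow>\<^sub>E B. g (vec_lambda s :: 'a ^ 'n::finite))"
  by (rule sum.reindex_bij_betw[OF bij_betw_vec_lambda_PiE, symmetric])

lemma finite_vec_entries:
  assumes "finite B"
  shows "finite {s :: 'a ^ 'n::finite. \<forall>j. s $ j \<in> B}"
  by (rule bij_betw_finite[OF bij_betw_vec_lambda_PiE, THEN iffD1], rule finite_PiE) (use assms in auto)

lemma prod_if_zero_const:
  fixes s :: "'i::finite \<Rightarrow> 'a::zero" and a b :: "'b::comm_monoid_mult"
  shows "(\<Prod>i\<in>UNIV. if s i = 0 then b else a)
    = a ^ (CARD('i) - card {i. s i = 0}) * b ^ card {i. s i = 0}"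
proof -
  have "card (- {i. s i = 0}) = CARD('i) - card {i. s i = 0}"
    by (simp add: Compl_eq_Diff_UNIV card_Diff_subset)
  then show ?thesis
    by (simp add: prod.If_cases mult.commute)
qed

text \<open>The cubic equation in variable \<open>i\<close>, put in the shape of
  \<open>expand\<close>: the scalars -1, 0, 1 encode subtracting \<open>z\<close>, omitting it and
  adding it.\<close>

lemma multi_cubic_coordinate:
  assumes "vector_space sV" and "multi_cubic sV sW f"
  shows "(\<Sum>b\<in>{-1, 1}. f (vec_lambda (h(i := sV 2 y + sV b z))))
    = (\<Sum>c\<in>{-1, 0, 1}. sW (if c = 0 then 12 else 2) (f (vec_lambda (h(i := y + sV c z)))))"
proof -
  interpret V: vector_space sV by fact
  have upd: "(\<chi> k. if k = i then x else (vec_lambda h) $ k) = vec_lambda (h(i := x))" for x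
    by (simp add: vec_eq_iff)
  have "cubic sV sW (\<lambda>x. f (vec_lambda (h(i := x))))"
    using assms(2)[unfolded multi_cubic_def, rule_format, of i "vec_lambda h"] unfolding upd .
  then have "f (vec_lambda (h(i := sV 2 y + z))) + f (vec_lambda (h(i := sV 2 y - z)))
    = sW 2 (f (vec_lambda (h(i := y + z)))) + sW 2 (f (vec_lambda (h(i := y - z))))
      + sW 12 (f (vec_lambda (h(i := y))))"
    unfolding cubic_def by (elim allE)
  then show ?thesis
    by (simp add: add.commute add.left_commute)
qed

theorem proposition2p2:
  fixes sV :: "rat \<Rightarrow> 'v::ab_group_add \<Rightarrow> 'v"
    and sW :: "rat \<Rightarrow> 'w::ab_group_add \<Rightarrow> 'w"
    and f :: "'v ^ 'n::finite \<Rightarrow> 'w"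
  assumes "vector_space sV" and "vector_space sW"
    and "multi_cubic sV sW f"
  shows "\<forall>x1 x2 :: 'v ^ 'n.
    (\<Sum>q | \<forall>j. q $ j \<in> {-1, 1}. f (scale_vec sV 2 x1 + scale_tuple sV q x2))
      = (\<Sum>k = 0..CARD('n). sW (2 ^ (CARD('n) - k) * 12 ^ k) (M_sum sV f k x1 x2))"
proof (intro allI)
  fix x1 x2 :: "'v ^ 'n"
  interpret W: vector_space sW by fact
  let ?C = "{-1, 0, 1} :: rat set"
  let ?zeros = "\<lambda>s :: rat ^ 'n. card {j. s $ j = 0}"
  let ?w = "\<lambda>k. 2 ^ (CARD('n) - k) * 12 ^ k :: rat"
  let ?S = "{s :: rat ^ 'n. \<forall>j. s $ j \<in> ?C}"
  let ?G = "\<lambda>s. f (x1 + scale_tuple sV s x2)"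
  have left: "scale_vec sV 2 x1 + scale_tuple sV (vec_lambda q) x2
      = (\<chi> i. sV 2 (x1 $ i) + sV (q i) (x2 $ i))"
    and right: "x1 + scale_tuple sV (vec_lambda q) x2 = (\<chi> i. x1 $ i + sV (q i) (x2 $ i))" for q
    by (simp_all add: scale_vec_def scale_tuple_def vec_eq_iff)
  have "(\<Sum>q | \<forall>j. q $ j \<in> {-1, 1}. f (scale_vec sV 2 x1 + scale_tuple sV q x2))
      = (\<Sum>q\<in>UNIV \<rightarrow>\<^sub>E {-1, 1}. f (\<chi> i. sV 2 (x1 $ i) + sV (q i) (x2 $ i)))"
    unfolding sum_vec_eq_sum_PiE left ..
  also have "\<dots> = (\<Sum>s\<in>UNIV \<rightarrow>\<^sub>E ?C. sW (\<Prod>i\<in>UNIV. if s i = 0 then 12 else 2)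
      (f (\<chi> i. x1 $ i + sV (s i) (x2 $ i))))"
    \<comment> \<open>For \<open>A = UNIV\<close> every coordinate is overridden, so both sides are
      the same for every base tuple \<open>h\<close>.\<close>
    using W.sum_PiE_expand_coordinatewise[of UNIV "\<lambda>h. f (vec_lambda h)",
        OF _ multi_cubic_coordinate[OF assms(1,3)]]
    by (simp add: override_on_def)
  also have "\<dots> = (\<Sum>s\<in>?S. sW (?w (?zeros s)) (?G s))"
    unfolding sum_vec_eq_sum_PiE right prod_if_zero_const by simp
  \<comment> \<open>The weight depends on \<open>s\<close> only through its number of zeros, so it
    is constant on each group and can then be pulled out in front of \<open>M_sum\<close>.\<close>
  also have "\<dots> = (\<Sum>k = 0..CARD('n). \<Sum>s\<in>{s \<in> ?S. ?zeros s = k}. sW (?w (?zeros s)) (?G s))"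
  proof (rule sum.group[symmetric])
    show "finite ?S" by (rule finite_vec_entries) simp
    show "?zeros ` ?S \<subseteq> {0..CARD('n)}" by (auto intro!: card_mono)
  qed simp
  also have "\<dots> = (\<Sum>k = 0..CARD('n). sW (?w k) (M_sum sV f k x1 x2))"
    unfolding M_sum_def W.scale_sum_right by (intro sum.cong) auto
  finally show "(\<Sum>q | \<forall>j. q $ j \<in> {-1, 1}. f (scale_vec sV 2 x1 + scale_tuple sV q x2))
      = (\<Sum>k = 0..CARD('n). sW (?w k) (M_sum sV f k x1 x2))" .
qed

end
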